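(* Let $X$ be a path-connected ANR space with basepoint $x_0$ and $n\ge 1$ an integer. Let $p_0:RP_0(\mathcal B_n(X))\to\mathcal B_n(X)$ be the evaluation map $p_0(\phi)=\phi(0)$, let $\omega_n:X\to\mathcal B_n(X)$ be $\omega_n(x)=\delta_x$, and let $q:\mathcal V_n\to X$ be the pullback of $p_0$ along $\omega_n$. Then $\mathsf{icat}(X)<n$ if and only if there exists a (continuous) section of the map $q:\mathcal V_n\to X$.
   Context: $I=[0,1]$. For a metric space $Z$ and $n\ge 1$, $\mathcal B_n(Z)$ is the space of probability measures on $Z$ whose support has at most $n$ points, written as finite formal convex combinations $\sum\lambda_z z$ with $\lambda_z>0$, $\sum\lambda_z=1$, equipped with the Lévy–Prokhorov metric; $\delta_z$ is the Dirac measure at $z$. $P(Z)$ is the space of continuous paths $I\to Z$ with the compact-open topology. Define $\Phi_n:\mathcal B_n(P(X))\to P(\mathcal B_n(X))$ by $\Phi_n(\sum\lambda_\alpha\alpha)(t)=\sum\lambda_\alpha\alpha(t)$. A path $f\in P(\mathcal B_n(X))$ is resolvable if $f=\Phi_n(\mu)$ for some $\mu\in\mathcal B_n(P(X))$; $RP(\mathcal B_n(X))\subset P(\mathcal B_n(X))$ is the subspace of resolvable paths, and $RP_0(\mathcal B_k(X))=\{f\in RP(\mathcal B_k(X)) : f(1)=\delta_{x_0}\}$. $\mathsf{icat}(X)$ is the minimal integer $n\ge 0$ such that there is a continuous $H:X\to RP_0(\mathcal B_{n+1}(X))$ with $H(x)(0)=\delta_x$ for all $x\in X$ (infinite if no such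 $n$ exists). *)

theory Defs
  imports "HOL-Probability.Probability" "HOL-Library.Extended_Nat"
begin

text \<open>
  A measure with finite support is a \<^typ>\<open>'a pmf\<close>: the formal convex combination
  \<open>\<Sum> \<lambda>\<^sub>z z\<close> is the \<open>p\<close> with \<open>pmf p z = \<lambda>\<^sub>z\<close>,
  the support is \<^term>\<open>set_pmf p\<close>, and \<open>\<delta>\<^sub>z\<close> is \<^term>\<open>return_pmf z\<close>.
\<close>

definition measures_supp_le :: "nat \<Rightarrow> 'a set \<Rightarrow> 'a pmf set" where
  "measures_supp_le n Z = {p. set_pmf p \<subseteq> Z \<and> finite (set_pmf p) \<and> card (set_pmf p) \<le> n}"

definition nbhd :: "'a metric \<Rightarrow> 'a set \<Rightarrow> real \<Rightarrow> 'a set" where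
  "nbhd Z A e = {y \<in> mspace Z. \<exists>x\<in>A. mdist Z x y < e}"

definition LP_set :: "'a metric \<Rightarrow> 'a pmf \<Rightarrow> 'a pmf \<Rightarrow> real set" where
  "LP_set Z p q = {e. e > 0 \<and>
     (\<forall>A \<in> sigma_sets (mspace Z) {U. openin (mtopology_of Z) U}.
        measure (measure_pmf p) A \<le> measure (measure_pmf q) (nbhd Z A e) + e \<and>
        measure (measure_pmf q) A \<le> measure (measure_pmf p) (nbhd Z A e) + e)}"

definition LP_dist :: "'a metric \<Rightarrow> 'a pmf \<Rightarrow> 'a pmf \<Rightarrow> real" where
  "LP_dist Z p q = Inf (LP_set Z p q)"

definition B_space :: "nat \<Rightarrow> 'a metric \<Rightarrow> 'a pmf metric" where
  "B_space n Z = metric (measures_supp_le n (mspace Z), LP_dist Z)"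

text \<open>The next lemmas show that \<^const>\<open>LP_dist\<close> is a metric on \<^const>\<open>measures_supp_le\<close>;
  without this, \<^const>\<open>B_space\<close> would be unspecified.\<close>

lemma LP_set_pos: "e \<in> LP_set Z p q \<Longrightarrow> 0 < e"
  by (simp add: LP_set_def)

lemma LP_set_one: "1 \<in> LP_set Z p q"
proof -
  have "measure (measure_pmf r) A \<le> measure (measure_pmf s) B + 1" for r s :: "'a pmf" and A B
    using measure_pmf.prob_le_1[of r A] measure_nonneg[of "measure_pmf s" B] by linarith
  then show ?thesis by (simp add: LP_set_def)
qed

lemma LP_set_commute: "LP_set Z p q = LP_set Z q p"
  by (auto simp: LP_set_def)

lemma LP_set_bdd: "bdd_below (LP_set Z p q)"
  by (meson LP_set_pos bdd_belowI less_imp_le)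

lemma LP_dist_nonneg: "0 \<le> LP_dist Z p q"
  unfolding LP_dist_def
proof (rule cInf_greatest)
  show "LP_set Z p q \<noteq> {}" using LP_set_one by blast
qed (use LP_set_pos less_imp_le in blast)

lemma LP_dist_less: "LP_dist Z p q < c \<Longrightarrow> \<exists>e\<in>LP_set Z p q. e < c"
  unfolding LP_dist_def by (rule cInf_lessD) (use LP_set_one in blast)

lemma nbhd_borel:
  assumes "A \<subseteq> mspace Z"
  shows "nbhd Z A e \<in> sigma_sets (mspace Z) {U. openin (mtopology_of Z) U}"
proof -
  interpret Metric_space "mspace Z" "mdist Z" by simp
  have "nbhd Z A e = (\<Union>x\<in>A. mball x e)"
    using assms by (force simp: nbhd_def)
  then have "openin (mtopology_of Z) (nbhd Z A e)"
    by (auto simp: mtopology_of_def)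
  then show ?thesis by (auto intro: sigma_sets.Basic)
qed

lemma borel_subset:
  assumes "A \<in> sigma_sets (mspace Z) {U. openin (mtopology_of Z) U}"
  shows "A \<subseteq> mspace Z"
  by (rule sigma_sets_into_sp[OF _ assms]) (use openin_subset in fastforce)

lemma singleton_borel:
  assumes "z \<in> mspace Z"
  shows "{z} \<in> sigma_sets (mspace Z) {U. openin (mtopology_of Z) U}"
proof -
  interpret Metric_space "mspace Z" "mdist Z" by simp
  have "openin (mtopology_of Z) (mspace Z - {z})"
    using closedin_Hausdorff_sing_eq[OF Hausdorff_space_mtopology, of z] assms
    by (simp add: closedin_def mtopology_of_def)
  then have "mspace Z - (mspace Z - {z}) \<in> sigma_sets (mspace Z) {U. openin (mtopology_of Z) U}"
    by (intro sigma_sets.Compl sigma_sets.Basic) simp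
  moreover have "mspace Z - (mspace Z - {z}) = {z}" using assms by auto
  ultimately show ?thesis by simp
qed

lemma LP_set_triangle:
  assumes a: "a \<in> LP_set Z p q" and b: "b \<in> LP_set Z q r"
  shows "a + b \<in> LP_set Z p r"
proof -
  let ?B = "sigma_sets (mspace Z) {U. openin (mtopology_of Z) U}"
  interpret Metric_space "mspace Z" "mdist Z" by simp
  have half: "measure (measure_pmf p') A \<le> measure (measure_pmf r') (nbhd Z A (c + d)) + (c + d)"
    if c: "c \<in> LP_set Z p' q'" and d: "d \<in> LP_set Z q' r'" and A: "A \<in> ?B" for p' q' r' c d A
  proof -
    have "nbhd Z (nbhd Z A c) d \<subseteq> nbhd Z A (c + d)"
    proof
      fix y assume "y \<in> nbhd Z (nbhd Z A c) d"
      then obtain x w where "x \<in> A" "mdist Z x w < c" "mdist Z w y < d" "y \<in> mspace Z" "w \<in> mspace Z"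
        by (auto simp: nbhd_def)
      moreover from this have "x \<in> mspace Z" using borel_subset[OF A] by auto
      ultimately show "y \<in> nbhd Z A (c + d)"
        using triangle[of x w y] by (auto simp: nbhd_def intro!: bexI[of _ x])
    qed
    then have "measure (measure_pmf r') (nbhd Z (nbhd Z A c) d) \<le> measure (measure_pmf r') (nbhd Z A (c + d))"
      by (intro measure_pmf.finite_measure_mono) auto
    moreover have "measure (measure_pmf p') A \<le> measure (measure_pmf q') (nbhd Z A c) + c"
      using c A by (auto simp: LP_set_def)
    moreover have "measure (measure_pmf q') (nbhd Z A c) \<le> measure (measure_pmf r') (nbhd Z (nbhd Z A c) d) + d"
      using d nbhd_borel[OF borel_subset[OF A], of c] by (auto simp: LP_set_def)
    ultimately show ?thesis by linarith
  qed
  have "measure (measure_pmf p) A \<le> measure (measure_pmf r) (nbhd Z A (a + b)) + (a + b)"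
       "measure (measure_pmf r) A \<le> measure (measure_pmf p) (nbhd Z A (a + b)) + (a + b)" if "A \<in> ?B" for A
    using half[OF a b that] half[of b r q a p A] a b that LP_set_commute[of Z]
    by (auto simp: add.commute)
  then show ?thesis using a b by (auto simp: LP_set_def)
qed

lemma LP_dist_triangle: "LP_dist Z p r \<le> LP_dist Z p q + LP_dist Z q r"
proof (rule field_le_epsilon)
  fix e :: real assume "0 < e"
  then obtain a b where ab: "a \<in> LP_set Z p q" "a < LP_dist Z p q + e/2"
      "b \<in> LP_set Z q r" "b < LP_dist Z q r + e/2"
    using LP_dist_less[of Z p q "LP_dist Z p q + e/2"] LP_dist_less[of Z q r "LP_dist Z q r + e/2"]
    by auto
  have "LP_dist Z p r \<le> a + b"
    unfolding LP_dist_def[of Z p r]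
    by (rule cInf_lower[OF LP_set_triangle[OF ab(1,3)] LP_set_bdd])
  then show "LP_dist Z p r \<le> LP_dist Z p q + LP_dist Z q r + e" using ab by linarith
qed

lemma LP_dist_refl: "LP_dist Z p p = 0"
proof (rule antisym[OF _ LP_dist_nonneg], rule field_le_epsilon)
  fix e :: real assume e: "0 < e"
  interpret Metric_space "mspace Z" "mdist Z" by simp
  have "measure (measure_pmf p) A \<le> measure (measure_pmf p) (nbhd Z A e) + e"
    if "A \<in> sigma_sets (mspace Z) {U. openin (mtopology_of Z) U}" for A
  proof -
    have "A \<subseteq> nbhd Z A e" using borel_subset[OF that] e by (force simp: nbhd_def)
    then have "measure (measure_pmf p) A \<le> measure (measure_pmf p) (nbhd Z A e)"
      by (intro measure_pmf.finite_measure_mono) auto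
    then show ?thesis using e by simp
  qed
  then have "e \<in> LP_set Z p p" using e by (simp add: LP_set_def)
  then show "LP_dist Z p p \<le> 0 + e"
    unfolding LP_dist_def by (simp add: cInf_lower[OF _ LP_set_bdd])
qed

lemma LP_dist_zero_pmf_le:
  assumes "finite (set_pmf q)" "set_pmf q \<subseteq> mspace Z" "z \<in> mspace Z" "LP_dist Z p q = 0"
  shows "pmf p z \<le> pmf q z"
proof (rule field_le_epsilon)
  fix e :: real assume e: "0 < e"
  interpret Metric_space "mspace Z" "mdist Z" by simp
  define d where "d = Min (insert e (mdist Z z ` (set_pmf q - {z})))"
  have "0 < mdist Z z y" if "y \<in> set_pmf q - {z}" for y
    using that assms by (metis DiffD1 DiffD2 insertI1 mdist_pos_eq subsetD)
  then have "0 < d" using e assms(1) by (auto simp: d_def)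
  then obtain c where c: "c \<in> LP_set Z p q" "c < d"
    using LP_dist_less[of Z p q d] assms by auto
  have far: "mdist Z z y \<ge> d" if "y \<in> set_pmf q" "y \<noteq> z" for y
    using that assms(1) unfolding d_def by (intro Min_le) auto
  have "d \<le> e" using assms(1) unfolding d_def by (intro Min_le) auto
  have "measure (measure_pmf p) {z} \<le> measure (measure_pmf q) (nbhd Z {z} c) + c"
    using c(1) singleton_borel[OF assms(3)] by (auto simp: LP_set_def)
  also have "measure (measure_pmf q) (nbhd Z {z} c) = measure (measure_pmf q) (nbhd Z {z} c \<inter> set_pmf q)"
    by (simp add: measure_Int_set_pmf)
  also have "\<dots> \<le> measure (measure_pmf q) {z}"
  proof (rule measure_pmf.finite_measure_mono)
    show "nbhd Z {z} c \<inter> set_pmf q \<subseteq> {z}" using far c(2) by (force simp: nbhd_def)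
  qed auto
  finally show "pmf p z \<le> pmf q z + e" using c(2) \<open>d \<le> e\<close> by (simp add: measure_pmf_single)
qed

lemma LP_dist_commute: "LP_dist Z p q = LP_dist Z q p"
  by (simp add: LP_dist_def LP_set_commute)

lemma Metric_space_LP: "Metric_space (measures_supp_le n (mspace Z)) (LP_dist Z)"
proof
  fix p q
  assume pq: "p \<in> measures_supp_le n (mspace Z)" "q \<in> measures_supp_le n (mspace Z)"
  show "LP_dist Z p q = 0 \<longleftrightarrow> p = q"
  proof
    assume 0: "LP_dist Z p q = 0"
    show "p = q"
    proof (rule pmf_eqI)
      fix z
      show "pmf p z = pmf q z"
      proof (cases "z \<in> mspace Z")
        case True
        then show ?thesis
          using LP_dist_zero_pmf_le[of q Z z p] LP_dist_zero_pmf_le[of p Z z q] 0 pq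
            LP_dist_commute[of Z p q] by (force simp: measures_supp_le_def)
      next
        case False
        then have "z \<notin> set_pmf p" "z \<notin> set_pmf q" using pq by (auto simp: measures_supp_le_def)
        then show ?thesis by (simp add: set_pmf_iff)
      qed
    qed
  qed (simp add: LP_dist_refl)
qed (use LP_dist_nonneg LP_dist_commute LP_dist_triangle in auto)

lemma mspace_B_space [simp]: "mspace (B_space n Z) = measures_supp_le n (mspace Z)"
  and mdist_B_space [simp]: "mdist (B_space n Z) = LP_dist Z"
  unfolding B_space_def
  using Metric_space.mspace_metric[OF Metric_space_LP] Metric_space.mdist_metric[OF Metric_space_LP]
  by auto

text \<open>Maps on a carrier are represented by their extensional representatives, as in
  \<^const>\<open>product_topology\<close>.\<close>

definition cont_maps :: "'a topology \<Rightarrow> 'b topology \<Rightarrow> ('a \<Rightarrow> 'b) set" where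
  "cont_maps X Y = {f \<in> extensional (topspace X). continuous_map X Y f}"

definition compact_open_topology :: "'a topology \<Rightarrow> 'b topology \<Rightarrow> ('a \<Rightarrow> 'b) topology" where
  "compact_open_topology X Y =
     topology_generated_by {{f \<in> cont_maps X Y. f ` K \<subseteq> U} |K U. compactin X K \<and> openin Y U}"

lemma topspace_compact_open_topology [simp]:
  "topspace (compact_open_topology X Y) = cont_maps X Y"
  unfolding compact_open_topology_def topology_generated_by_topspace
  by (auto intro!: exI[of _ "cont_maps X Y"] exI[of _ "{}"])

definition path_space :: "'a topology \<Rightarrow> (real \<Rightarrow> 'a) topology" where
  "path_space Z = compact_open_topology (top_of_set {0..1}) Z"

text \<open>\<^term>\<open>map_pmf (\<lambda>\<alpha>. \<alpha> t)\<close> sends \<open>\<Sum> \<lambda>\<^sub>\<alpha> \<alpha>\<close> to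
  \<open>\<Sum> \<lambda>\<^sub>\<alpha> \<alpha>(t)\<close>, merging the weights of paths that agree at \<open>t\<close>.\<close>

definition Phi :: "(real \<Rightarrow> 'a) pmf \<Rightarrow> real \<Rightarrow> 'a pmf" where
  "Phi \<mu> = (\<lambda>t\<in>{0..1}. map_pmf (\<lambda>\<alpha>. \<alpha> t) \<mu>)"

text \<open>Only the underlying set of \<open>B\<^sub>n(P(X))\<close> enters the notion of resolvability.\<close>

definition resolvable :: "nat \<Rightarrow> 'a metric \<Rightarrow> (real \<Rightarrow> 'a pmf) \<Rightarrow> bool" where
  "resolvable n X f \<longleftrightarrow>
     (\<exists>\<mu> \<in> measures_supp_le n (topspace (path_space (mtopology_of X))). f = Phi \<mu>)"

definition RP :: "nat \<Rightarrow> 'a metric \<Rightarrow> (real \<Rightarrow> 'a pmf) topology" where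
  "RP n X = subtopology (path_space (mtopology_of (B_space n X))) {f. resolvable n X f}"

definition RP0 :: "nat \<Rightarrow> 'a metric \<Rightarrow> 'a \<Rightarrow> (real \<Rightarrow> 'a pmf) topology" where
  "RP0 n X x0 = subtopology (RP n X) {f. f 1 = return_pmf x0}"

definition icat :: "'a metric \<Rightarrow> 'a \<Rightarrow> enat" where
  "icat X x0 = Inf {enat n |n. \<exists>H. continuous_map (mtopology_of X) (RP0 (n + 1) X x0) H \<and>
                                  (\<forall>x \<in> mspace X. H x 0 = return_pmf x)}"

definition pullback_space ::
  "'a topology \<Rightarrow> 'b topology \<Rightarrow> ('a \<Rightarrow> 'c) \<Rightarrow> ('b \<Rightarrow> 'c) \<Rightarrow> ('a \<times> 'b) topology" where
  "pullback_space X Y f g = subtopology (prod_topology X Y) {(x, y). f x = g y}"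

definition p0 :: "(real \<Rightarrow> 'a pmf) \<Rightarrow> 'a pmf" where
  "p0 \<phi> = \<phi> 0"

definition omega :: "'a \<Rightarrow> 'a pmf" where
  "omega x = return_pmf x"

definition V_space :: "nat \<Rightarrow> 'a metric \<Rightarrow> 'a \<Rightarrow> ('a \<times> (real \<Rightarrow> 'a pmf)) topology" where
  "V_space n X x0 = pullback_space (mtopology_of X) (RP0 n X x0) omega p0"

definition q_map :: "'a \<times> (real \<Rightarrow> 'a pmf) \<Rightarrow> 'a" where
  "q_map = fst"

text \<open>
  Absolute neighbourhood retracts for metrizable spaces: every closed copy in a metrizable space
  is a retract of an open neighbourhood.  \<^const>\<open>ANR\<close> is tailored to subsets of Euclidean spaces:
  its ambient spaces are subsets of \<open>'a \<times> real\<close>.  Ambient spaces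
  on the type \<open>'a \<Rightarrow> real\<close> lose no generality: by the Kuratowski-Wojdyslawski theorem \<open>X\<close>
  embeds as a closed subset of a convex subset of the Banach space of bounded continuous functions
  on \<open>X\<close>, and by Dugundji's extension theorem a neighbourhood retraction there yields one for
  closed copies in arbitrary metrizable spaces.
\<close>

definition ANR_space :: "'a topology \<Rightarrow> bool" where
  "ANR_space X \<longleftrightarrow> metrizable_space X \<and>
     (\<forall>(Y :: ('a \<Rightarrow> real) topology) C.
        metrizable_space Y \<and> closedin Y C \<and> X homeomorphic_space subtopology Y C \<longrightarrow>
        (\<exists>U. openin Y U \<and> C \<subseteq> U \<and> C retract_of_space subtopology Y U))"

end

theory Submission
  imports Defs
begin

text \<open>
  A section of the pullback \<open>q\<close> is the same thing as a map \<open>H\<close> from \<open>X\<close> to the resolvable paths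
  in \<open>B\<^sub>n(X)\<close> ending at \<open>\<delta>\<close> of the basepoint, with \<open>H(x)\<close> starting at \<open>\<delta>\<^sub>x\<close>: the first coordinate
  of a section is forced to be \<open>x\<close>, and membership in the pullback is exactly the condition on the
  starting point.  So the sections over \<open>X\<close> are the witnesses for \<open>icat(X) \<le> n - 1\<close>
  (\<open>section_iff_contraction\<close>).

  What remains is that a witness for some \<open>m < n\<close> gives one for \<open>n - 1\<close>.  This holds because
  \<open>B\<^sub>k(X)\<close> carries the same distance for every \<open>k\<close>, so that \<open>B\<^sub>k(X)\<close> embeds isometrically in
  \<open>B\<^sub>l(X)\<close> for \<open>k \<le> l\<close>, and the compact-open topology is functorial in the target; on
  resolvable paths this gives a continuous inclusion (\<open>continuous_map_RP0_mono\<close>).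
\<close>

text \<open>
  The representatives in \<^const>\<open>cont_maps\<close> are extensional on the source alone, so a
  continuous inclusion of targets acts on them as the identity.
\<close>

lemma continuous_map_compact_open_id:
  assumes "continuous_map Y Y' id"
  shows "continuous_map (compact_open_topology X Y) (compact_open_topology X Y') id"
proof -
  let ?W = "\<lambda>Z K U. {f \<in> cont_maps X Z. f ` K \<subseteq> U}"
  have sub: "cont_maps X Y \<subseteq> cont_maps X Y'"
    using continuous_map_compose[OF _ assms] by (auto simp: cont_maps_def)
  have pre: "openin (compact_open_topology X Y) (?W Y' K U \<inter> cont_maps X Y)"
    if K: "compactin X K" and U: "openin Y' U" for K U
  proof -
    \<comment> \<open>Maps in \<open>cont_maps X Y\<close> send \<open>K\<close> into the carrier of \<open>Y\<close>, so \<open>U\<close> can be cut down to it.\<close>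
    have "?W Y' K U \<inter> cont_maps X Y = ?W Y K {y \<in> topspace Y. y \<in> U}"
    proof (intro set_eqI iffI)
      fix f assume f: "f \<in> ?W Y' K U \<inter> cont_maps X Y"
      then have "f ` K \<subseteq> topspace Y"
        using compactin_subset_topspace[OF K] continuous_map_image_subset_topspace[of X Y f]
        by (auto simp: cont_maps_def)
      then show "f \<in> ?W Y K {y \<in> topspace Y. y \<in> U}" using f by blast
    qed (use sub in blast)
    moreover have "openin Y {y \<in> topspace Y. y \<in> U}"
      using openin_continuous_map_preimage[OF assms U] by simp
    ultimately show ?thesis
      unfolding compact_open_topology_def using K by (auto intro!: topology_generated_by_Basis)
  qed
  show ?thesis
    unfolding compact_open_topology_def[of X Y']
  proof (rule continuous_on_generated_topo)
    fix V assume "V \<in> {?W Y' K U |K U. compactin X K \<and> openin Y' U}"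
    then show "openin (compact_open_topology X Y) (id -` V \<inter> topspace (compact_open_topology X Y))"
      using pre by auto
  next
    have "cont_maps X Y' = ?W Y' {} {}" by simp
    then have "cont_maps X Y' \<in> {?W Y' K U |K U. compactin X K \<and> openin Y' U}"
      using compactin_empty openin_empty by blast
    then show "id ` topspace (compact_open_topology X Y)
        \<subseteq> \<Union> {?W Y' K U |K U. compactin X K \<and> openin Y' U}"
      using sub by auto
  qed
qed

lemma measures_supp_le_mono: "m \<le> n \<Longrightarrow> measures_supp_le m Z \<subseteq> measures_supp_le n Z"
  by (auto simp: measures_supp_le_def)

lemma continuous_map_B_space_mono:
  assumes "m \<le> n"
  shows "continuous_map (mtopology_of (B_space m Z)) (mtopology_of (B_space n Z)) id"
proof (rule Lipschitz_continuous_imp_continuous_map)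
  show "Lipschitz_continuous_map (B_space m Z) (B_space n Z) id"
    unfolding Lipschitz_continuous_map_def
    using measures_supp_le_mono[OF assms, of "mspace Z"] by (auto intro!: exI[of _ 1])
qed

lemma resolvable_mono: "m \<le> n \<Longrightarrow> resolvable m X f \<Longrightarrow> resolvable n X f"
  unfolding resolvable_def using measures_supp_le_mono by blast

lemma continuous_map_RP0_mono:
  assumes "m \<le> n"
  shows "continuous_map (RP0 m X x0) (RP0 n X x0) id"
proof -
  have "continuous_map (path_space (mtopology_of (B_space m X)))
          (path_space (mtopology_of (B_space n X))) id"
    unfolding path_space_def
    by (intro continuous_map_compact_open_id continuous_map_B_space_mono assms)
  then show ?thesis
    unfolding RP0_def RP_def subtopology_subtopology
    by (auto simp: continuous_map_in_subtopology continuous_map_from_subtopology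
             intro: resolvable_mono[OF assms])
qed

text \<open>The universal property of the pullback, for maps whose first coordinate is the identity.\<close>

lemma section_iff_contraction:
  "(\<exists>s. continuous_map (mtopology_of X) (V_space n X x0) s \<and> (\<forall>x \<in> mspace X. q_map (s x) = x)) \<longleftrightarrow>
   (\<exists>H. continuous_map (mtopology_of X) (RP0 n X x0) H \<and> (\<forall>x \<in> mspace X. H x 0 = return_pmf x))"
proof safe
  fix s
  assume q: "\<forall>x \<in> mspace X. q_map (s x) = x"
    and "continuous_map (mtopology_of X) (V_space n X x0) s"
  from this(2) have "continuous_map (mtopology_of X) (prod_topology (mtopology_of X) (RP0 n X x0)) s"
    and pb: "\<And>x. x \<in> mspace X \<Longrightarrow> s x \<in> {(x, \<phi>). omega x = p0 \<phi>}"
    unfolding V_space_def pullback_space_def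
    by (auto simp: continuous_map_in_subtopology Pi_iff)
  then have "continuous_map (mtopology_of X) (RP0 n X x0) (snd \<circ> s)"
    by (intro continuous_map_compose[OF _ continuous_map_snd])
  moreover have "(snd \<circ> s) x 0 = return_pmf x" if "x \<in> mspace X" for x
    using pb[OF that] q that by (auto simp: omega_def p0_def q_map_def split_beta)
  ultimately show "\<exists>H. continuous_map (mtopology_of X) (RP0 n X x0) H \<and>
      (\<forall>x \<in> mspace X. H x 0 = return_pmf x)"
    by blast
next
  fix H
  assume "continuous_map (mtopology_of X) (RP0 n X x0) H" "\<forall>x \<in> mspace X. H x 0 = return_pmf x"
  then have "continuous_map (mtopology_of X) (V_space n X x0) (\<lambda>x. (x, H x))"
    unfolding V_space_def pullback_space_def
    by (auto simp: continuous_map_in_subtopology omega_def p0_def intro!: continuous_map_pairedI)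
  then show "\<exists>s. continuous_map (mtopology_of X) (V_space n X x0) s \<and>
      (\<forall>x \<in> mspace X. q_map (s x) = x)"
    by (intro exI[of _ "\<lambda>x. (x, H x)"]) (simp add: q_map_def)
qed

theorem proposition6p2:
  fixes X :: "'a metric" and x0 :: 'a and n :: nat
  assumes "path_connected_space (mtopology_of X)"
    and "ANR_space (mtopology_of X)"
    and "x0 \<in> mspace X"
    and "n \<ge> 1"
  shows "icat X x0 < enat n \<longleftrightarrow>
         (\<exists>s. continuous_map (mtopology_of X) (V_space n X x0) s \<and>
              (\<forall>x \<in> mspace X. q_map (s x) = x))"
proof -
  let ?C = "\<lambda>k. \<exists>H. continuous_map (mtopology_of X) (RP0 k X x0) H \<and>
                    (\<forall>x \<in> mspace X. H x 0 = return_pmf x)"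
  have mono: "?C l" if "?C k" "k \<le> l" for k l
  proof -
    from that(1) obtain H where H: "continuous_map (mtopology_of X) (RP0 k X x0) H"
        "\<forall>x \<in> mspace X. H x 0 = return_pmf x" by blast
    have "continuous_map (mtopology_of X) (RP0 l X x0) H"
      using continuous_map_compose[OF H(1) continuous_map_RP0_mono[OF that(2)]] by simp
    with H(2) show ?thesis by blast
  qed
  have "icat X x0 < enat n \<longleftrightarrow> (\<exists>m<n. ?C (m + 1))"
    unfolding icat_def Inf_less_iff using enat_ord_simps(2) by blast
  also have "\<dots> \<longleftrightarrow> ?C n"
  proof
    assume "\<exists>m<n. ?C (m + 1)"
    then obtain m where "m < n" "?C (m + 1)" by blast
    then show "?C n" by (intro mono[of "m + 1" n]) auto
  next
    assume "?C n"
    then show "\<exists>m<n. ?C (m + 1)"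
      using \<open>n \<ge> 1\<close> by (intro exI[of _ "n - 1"]) simp
  qed
  finally show ?thesis by (simp only: section_iff_contraction)
qed

end
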